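(* Let $\epsilon>0$, let $n,m$ be integers with $m>2n$ (and $m\le \binom n2$, so that simple graphs with $n$ vertices and $m$ edges exist), and let $\delta\in[0,1]$ satisfy $\delta \le (n/m)^{\Omega(1)}$. Then there exist a graph topology $F=(V,E)$ with $n$ vertices and $m$ edges and a probability distribution $\mathcal{D}_\omega$ on weight vectors $\mathbf{w}\in\mathbb{R}^{E}$ such that for every $(\epsilon,\delta)$-differentially private (under the $\ell_1$ neighboring relation on weights) randomized algorithm $\mathcal{A}$ that, on input $(F,\mathbf{w})$, outputs a spanning tree $T$ of $F$ (an approximate minimum spanning tree), if $\mathbf{w}\sim\mathcal{D}_\omega$ then the expected additive error satisfies $$\mathbb{E}\big[w(T)-w(T^* )\big]\ \ge\ \Omega\Big(\frac{n}{\epsilon}\cdot\min\big(\ln(1/\delta),\,\ln(m/n)\big)\Big),$$ where $T^*$ is a minimum-weight spanning tree of $F$ with respect to $\mathbf{w}$ and the expectation is over $\mathbf{w}\sim\mathcal{D}_\omega$ and the randomness of $\mathcal{A}$.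
   Context: Graphs are finite, simple, undirected and connected; the topology $F=(V,E)$ is public and only the edge weights are private. For $S\subseteq E$, $w(S)=\sum_{e\in S}w(e)$. A spanning tree is an acyclic set of $n-1$ edges connecting all vertices. Two weight vectors $\mathbf{w},\mathbf{w}'\in\mathbb{R}^E$ on the same topology are neighboring if $\|\mathbf{w}-\mathbf{w}'\|_1\le 1$. A randomized algorithm $\mathcal{A}$ is $(\epsilon,\delta)$-differentially private if for all neighboring $\mathbf{w},\mathbf{w}'$ and all sets $Y$ of outputs, $\Pr[\mathcal{A}(F,\mathbf{w})\in Y]\le e^{\epsilon}\Pr[\mathcal{A}(F,\mathbf{w}')\in Y]+\delta$. Asymptotic notation: $\epsilon>0$ is a fixed parameter and $n,m$ are the asymptotic parameters; $\delta\le(n/m)^{\Omega(1)}$ means $\delta\le (n/m)^{\gamma}$ for a fixed constant $\gamma>0$; $\Omega(\cdot)$ in the conclusion hides a positive constant factor that does not depend on $n,m,\delta$. For $\delta=0$, $\ln(1/\delta)=+\infty$. *)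

theory Defs
  imports "HOL-Probability.Probability"
begin

section \<open>Graph topologies and spanning trees\<close>

text \<open>An undirected edge is a two-element set of vertices.\<close>

definition connects :: "'v set \<Rightarrow> 'v set set \<Rightarrow> bool" where
  "connects V S \<longleftrightarrow> (\<forall>u\<in>V. \<forall>v\<in>V. (u, v) \<in> {(x, y). {x, y} \<in> S}\<^sup>*)"

definition graph_topology :: "'v set \<Rightarrow> 'v set set \<Rightarrow> bool" where
  "graph_topology V E \<longleftrightarrow>
     finite V \<and> V \<noteq> {} \<and> E \<subseteq> {e. e \<subseteq> V \<and> card e = 2} \<and> connects V E"

definition is_cycle :: "'v set set \<Rightarrow> 'v list \<Rightarrow> bool" where
  "is_cycle S xs \<longleftrightarrow> 3 \<le> length xs \<and> distinct xs \<and>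
     (\<forall>i<length xs. {xs ! i, xs ! (Suc i mod length xs)} \<in> S)"

definition spanning_tree :: "'v set \<Rightarrow> 'v set set \<Rightarrow> 'v set set \<Rightarrow> bool" where
  "spanning_tree V E T \<longleftrightarrow>
     T \<subseteq> E \<and> (\<nexists>xs. is_cycle T xs) \<and> card T = card V - 1 \<and> connects V T"

text \<open>
  The weight of \<open>S\<close> is \<open>sum w S\<close>. Ties between minimum spanning trees are broken by choice;
  the weight of the chosen tree does not depend on it.
\<close>

definition min_spanning_tree ::
    "'v set \<Rightarrow> 'v set set \<Rightarrow> ('v set \<Rightarrow> real) \<Rightarrow> 'v set set" where
  "min_spanning_tree V E w = arg_min_on (sum w) {T. spanning_tree V E T}"


section \<open>Private algorithms\<close>

text \<open>
  Weight vectors in $\mathbb{R}^E$ are functions that are \<open>undefined\<close> outside \<open>E\<close>, so an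
  algorithm cannot depend on values outside \<open>E\<close>.
\<close>

abbreviation weight_space :: "'e set \<Rightarrow> ('e \<Rightarrow> real) measure" where
  "weight_space E \<equiv> Pi\<^sub>M E (\<lambda>_. borel)"

definition neighboring :: "'e set \<Rightarrow> ('e \<Rightarrow> real) \<Rightarrow> ('e \<Rightarrow> real) \<Rightarrow> bool" where
  "neighboring E w w' \<longleftrightarrow> (\<Sum>e\<in>E. \<bar>w e - w' e\<bar>) \<le> 1"

text \<open>
  For a public topology \<open>F = (V, E)\<close>, a randomized algorithm is a map \<open>A\<close> taking a weight vector
  \<open>w\<close> to the output distribution on the input \<open>(F, w)\<close>.
\<close>

definition differentially_private ::
    "real \<Rightarrow> real \<Rightarrow> 'e set \<Rightarrow> (('e \<Rightarrow> real) \<Rightarrow> 'b pmf) \<Rightarrow> bool" where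
  "differentially_private \<epsilon> \<delta> E A \<longleftrightarrow>
     (\<forall>w \<in> space (weight_space E). \<forall>w' \<in> space (weight_space E). neighboring E w w' \<longrightarrow>
        (\<forall>Y. measure_pmf.prob (A w) Y \<le> exp \<epsilon> * measure_pmf.prob (A w') Y + \<delta>))"

definition outputs_spanning_tree ::
    "'v set \<Rightarrow> 'v set set \<Rightarrow> (('v set \<Rightarrow> real) \<Rightarrow> 'v set set pmf) \<Rightarrow> bool" where
  "outputs_spanning_tree V E A \<longleftrightarrow>
     (\<forall>w \<in> space (weight_space E). \<forall>T \<in> set_pmf (A w). spanning_tree V E T)"

text \<open>
  The expectation of \<open>w(T) - w(T\<^sup>*)\<close>, which is nonnegative whenever \<open>T\<close> is a spanning tree; hence
  the value in \<open>[0, \<infinity>]\<close>. No measurability of \<open>A\<close> is assumed. If \<open>A\<close> is a Markov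
  kernel, this is the expectation; otherwise \<open>nn_integral\<close> is a lower integral, so a lower bound
  on it is the stronger claim.
\<close>

definition expected_error ::
    "'v set \<Rightarrow> 'v set set \<Rightarrow> ('v set \<Rightarrow> real) measure
       \<Rightarrow> (('v set \<Rightarrow> real) \<Rightarrow> 'v set set pmf) \<Rightarrow> ennreal" where
  "expected_error V E D A =
     (\<integral>\<^sup>+ w. (\<integral>\<^sup>+ T. ennreal (sum w T - sum w (min_spanning_tree V E w)) \<partial>measure_pmf (A w)) \<partial>D)"

text \<open>\<open>ln (1 / \<delta>)\<close> with the convention that it is \<open>\<infinity>\<close> at \<open>\<delta> = 0\<close>.\<close>

definition ln_inverse :: "real \<Rightarrow> ereal" where
  "ln_inverse \<delta> = (if \<delta> = 0 then \<infinity> else ereal (ln (1 / \<delta>)))"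

end

theory Submission
  imports Defs "HOL-Real_Asymp.Real_Asymp"
begin

text \<open>
  Take a core of \<open>k \<approx> m/n\<close> vertices joined to all the other vertices. Each of the latter has,
  independently and uniformly, one planted edge of weight \<open>0\<close> into the core; all its other edges
  weigh \<open>L\<close>. The planted edges and a star of weight \<open>0\<close> on the core form a spanning tree
  of weight \<open>0\<close>, so \<open>T\<close> pays about \<open>L\<close> for every outer vertex whose only edge in \<open>T\<close> is not
  the planted one. Moving a planted edge changes the weights by \<open>r = 2L\<close>, and the events that
  \<open>v\<close> is attached by exactly the edge to \<open>i\<close> are disjoint in \<open>i\<close>. Hence the average probability
  \<open>p\<close> that \<open>v\<close> is attached by exactly its planted edge satisfies
  \<open>p \<le> e\<^sup>\<epsilon>\<^sup>r (1 - p) / (k - 1) + \<delta>'\<close>, where \<open>\<delta>'\<close> is the loss of \<open>r\<close> steps of group privacy.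
  For large \<open>m/n\<close> take \<open>r\<close> a small multiple of \<open>ln (m/n)\<close>; for bounded \<open>m/n\<close> take \<open>r = 1\<close>, where
  \<open>\<delta>' = \<delta> \<le> 2 powr (-\<gamma>) < 1\<close> keeps \<open>p\<close> away from \<open>1\<close> although \<open>\<delta>\<close> need not be small.
\<close>

section \<open>Trees given by a parent function\<close>

text \<open>The root is \<open>0\<close>. This is used with \<open>p v < v\<close>, so that
  following parents ends at the root and the larger end of an edge is the child.\<close>

definition parent_edges :: "nat \<Rightarrow> (nat \<Rightarrow> nat) \<Rightarrow> nat set set" where
  "parent_edges n p = (\<lambda>v. {v, p v}) ` {0<..<n}"

lemma parent_edges_downward:
  assumes "\<And>v. 0 < v \<Longrightarrow> v < n \<Longrightarrow> p v < v" and "{a, b} \<in> parent_edges n p" and "b \<le> a"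
  shows "b = p a"
proof -
  obtain v where v: "0 < v" "v < n" "{a, b} = {v, p v}"
    using assms(2) by (auto simp: parent_edges_def)
  with assms(1)[OF v(1,2)] assms(3) show ?thesis by (auto simp: doubleton_eq_iff)
qed

lemma card_parent_edges:
  assumes "\<And>v. 0 < v \<Longrightarrow> v < n \<Longrightarrow> p v < v"
  shows "card (parent_edges n p) = n - 1"
proof -
  have "inj_on (\<lambda>v. {v, p v}) {0<..<n}"
  proof (rule inj_onI)
    fix u v assume "u \<in> {0<..<n}" "v \<in> {0<..<n}" "{u, p u} = {v, p v}"
    with assms[of u] assms[of v] show "u = v" by (auto simp: doubleton_eq_iff)
  qed
  then show ?thesis by (simp add: parent_edges_def card_image)
qed

text \<open>The largest vertex of a cycle has two distinct neighbours on it; neither is larger, so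
  both would be its parent.\<close>

lemma parent_edges_acyclic:
  assumes p: "\<And>v. 0 < v \<Longrightarrow> v < n \<Longrightarrow> p v < v"
  shows "\<not> is_cycle (parent_edges n p) xs"
proof
  assume c: "is_cycle (parent_edges n p) xs"
  define N where "N = length xs"
  from c have N: "3 \<le> N" and d: "distinct xs"
    and e: "\<And>i. i < N \<Longrightarrow> {xs ! i, xs ! (Suc i mod N)} \<in> parent_edges n p"
    by (auto simp: is_cycle_def N_def)
  have "Max (set xs) \<in> set xs" using N by (intro Max_in) (auto simp: N_def)
  then obtain i where i: "i < N" "xs ! i = Max (set xs)" by (auto simp: in_set_conv_nth N_def)
  have top: "xs ! l \<le> xs ! i" if "l < N" for l using that by (auto simp: i N_def)
  \<comment> \<open>Cyclic predecessor and successor positions of the maximum; length at least 3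
    keeps them apart.\<close>
  define h where "h = (if i = 0 then N - 1 else i - 1)"
  define s where "s = (if Suc i = N then 0 else Suc i)"
  have h: "h < N" "Suc h mod N = i" using i N by (auto simp: h_def)
  have s: "s < N" "Suc i mod N = s" using i N by (auto simp: s_def)
  have "xs ! s = p (xs ! i)"
    using parent_edges_downward[OF p _ top[OF s(1)]] e[OF i(1)] s by simp
  moreover have "xs ! h = p (xs ! i)"
    using parent_edges_downward[OF p _ top[OF h(1)]] e[OF h(1)] h by (simp add: insert_commute)
  ultimately have "xs ! h = xs ! s" by simp
  then have "h = s" using d h(1) s(1) by (simp add: N_def nth_eq_iff_index_eq)
  then show False using i N by (auto simp: h_def s_def split: if_splits)
qed

lemma connects_mono:
  assumes "connects V S" "S \<subseteq> S'"
  shows "connects V S'"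
proof -
  have "{(x, y). {x, y} \<in> S}\<^sup>* \<subseteq> {(x, y). {x, y} \<in> S'}\<^sup>*"
    using assms(2) by (intro rtrancl_mono) auto
  then show ?thesis using assms(1) by (auto simp: connects_def)
qed

lemma parent_edges_connects:
  assumes p: "\<And>v. 0 < v \<Longrightarrow> v < n \<Longrightarrow> p v < v"
  shows "connects {..<n} (parent_edges n p)"
proof -
  define R where "R = {(x, y). {x, y} \<in> parent_edges n p}"
  have "sym R" by (auto simp: R_def sym_def insert_commute)
  then have sy: "sym (R\<^sup>*)" by (rule sym_rtrancl)
  have 0: "(v, 0) \<in> R\<^sup>*" if "v < n" for v
    using that
  proof (induction v rule: less_induct)
    case (less v)
    show ?case
    proof (cases "v = 0")
      case False
      then have "(v, p v) \<in> R" using less.prems by (auto simp: R_def parent_edges_def)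
      moreover have "(p v, 0) \<in> R\<^sup>*" using less p[of v] False by auto
      ultimately show ?thesis by (rule converse_rtrancl_into_rtrancl)
    qed simp
  qed
  have "(u, v) \<in> R\<^sup>*" if "u < n" "v < n" for u v
    using 0[OF that(1)] symD[OF sy 0[OF that(2)]] by (rule rtrancl_trans)
  then show ?thesis by (simp add: connects_def R_def)
qed

lemma parent_edges_spanning_tree:
  assumes "\<And>v. 0 < v \<Longrightarrow> v < n \<Longrightarrow> p v < v" and "parent_edges n p \<subseteq> E"
  shows "spanning_tree {..<n} E (parent_edges n p)"
  using assms parent_edges_acyclic[of n p] card_parent_edges[of n p] parent_edges_connects[of n p]
  by (simp add: spanning_tree_def)

lemma connects_incident_edge:
  assumes "connects V S" "u \<in> V" "v \<in> V" "u \<noteq> v"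
  obtains e where "e \<in> S" "u \<in> e"
proof -
  have "(u, v) \<in> {(x, y). {x, y} \<in> S}\<^sup>*" using assms by (auto simp: connects_def)
  then show thesis
    by (cases rule: converse_rtranclE) (use assms(4) that in auto)
qed


section \<open>Group privacy\<close>

text \<open>Walk along the segment from \<open>w'\<close> to \<open>w\<close> in \<open>r\<close>
  equal steps of l1-length at most 1. Each step multiplies the accumulated bound by e^\<epsilon> and
  adds \<delta>.\<close>

lemma group_privacy:
  assumes dp: "differentially_private \<epsilon> \<delta> E A"
    and w: "w \<in> space (weight_space E)" "w' \<in> space (weight_space E)"
    and r: "0 < r" "(\<Sum>e\<in>E. \<bar>w e - w' e\<bar>) \<le> real r"
  shows "measure_pmf.prob (A w) Y
      \<le> exp (\<epsilon> * real r) * measure_pmf.prob (A w') Y + \<delta> * (\<Sum>i<r. exp (\<epsilon> * real i))"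
proof -
  define u where "u t = (\<lambda>e\<in>E. w' e + (real t / real r) * (w e - w' e))" for t
  have sp: "u t \<in> space (weight_space E)" for t by (auto simp: u_def space_PiM)
  have "measure_pmf.prob (A (u t)) Y
      \<le> exp (\<epsilon> * real t) * measure_pmf.prob (A (u 0)) Y + \<delta> * (\<Sum>i<t. exp (\<epsilon> * real i))" for t
  proof (induction t)
    case (Suc t)
    have "(\<Sum>e\<in>E. \<bar>u (Suc t) e - u t e\<bar>) = (\<Sum>e\<in>E. \<bar>w e - w' e\<bar>) / real r"
      unfolding sum_divide_distrib
    proof (intro sum.cong refl)
      fix e assume "e \<in> E"
      then have "u (Suc t) e - u t e = (w e - w' e) / real r"
        by (simp add: u_def field_simps add_divide_distrib)
      then show "\<bar>u (Suc t) e - u t e\<bar> = \<bar>w e - w' e\<bar> / real r" by simp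
    qed
    also have "\<dots> \<le> 1" using r by simp
    finally have "neighboring E (u (Suc t)) (u t)" by (simp add: neighboring_def)
    then have "measure_pmf.prob (A (u (Suc t))) Y \<le> exp \<epsilon> * measure_pmf.prob (A (u t)) Y + \<delta>"
      using dp sp by (auto simp: differentially_private_def)
    also have "\<dots> \<le> exp \<epsilon> * (exp (\<epsilon> * real t) * measure_pmf.prob (A (u 0)) Y
        + \<delta> * (\<Sum>i<t. exp (\<epsilon> * real i))) + \<delta>"
      using Suc by simp
    also have "\<dots> = exp (\<epsilon> * real (Suc t)) * measure_pmf.prob (A (u 0)) Y
        + \<delta> * (\<Sum>i<Suc t. exp (\<epsilon> * real i))"
      \<comment> \<open>Multiplying by e^\<epsilon> raises every index by one; the newly added
        \<delta> is the term for \<open>i = 0\<close>.\<close>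
      unfolding sum.lessThan_Suc_shift
      by (simp add: algebra_simps exp_add sum_distrib_left)
    finally show ?case .
  qed simp
  from this[of r] moreover have "u r = w" "u 0 = w'"
    using w r(1) by (auto simp: u_def space_PiM PiE_def extensional_def restrict_def fun_eq_iff)
  ultimately show ?thesis by simp
qed


section \<open>Random weights with finite support\<close>

lemma singleton_in_sets_weight_space:
  assumes "finite E" "w \<in> space (weight_space E)"
  shows "{w} \<in> sets (weight_space E)"
proof -
  have "w \<in> extensional E" using assms(2) by (auto simp: space_PiM PiE_def)
  then have "{w} = Pi\<^sub>E E (\<lambda>e. {w e})" by (simp add: PiE_singleton)
  also have "\<dots> \<in> sets (weight_space E)" by (intro sets_PiM_I_finite assms(1)) auto
  finally show ?thesis .
qed

lemma prob_pmf_Compl: "measure_pmf.prob q (- X) = 1 - measure_pmf.prob q X"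
  using measure_pmf.prob_compl[of X q] by (simp add: Compl_eq_Diff_UNIV)

lemma integrable_pmf_indicator: "integrable (measure_pmf q) (indicator X :: _ \<Rightarrow> real)"
  by (rule measure_pmf.integrable_const_bound[where B = 1]) auto

text \<open>As \<open>f\<close> may fail to be measurable, replace it by the function equal to it on
  the finite image of \<open>J\<close> and to 0 elsewhere. That function is measurable because
  singletons are, and it lies below \<open>f\<close>; hence only an inequality.\<close>

lemma nn_integral_distr_pmf_of_set_ge:
  fixes f :: "'b \<Rightarrow> ennreal"
  assumes J: "finite J" "J \<noteq> {}"
    and W: "\<And>j. W j \<in> space M" and M: "\<And>x. x \<in> space M \<Longrightarrow> {x} \<in> sets M"
  shows "(\<Sum>j\<in>J. f (W j)) / of_nat (card J)
           \<le> (\<integral>\<^sup>+ x. f x \<partial>distr (measure_pmf (pmf_of_set J)) M W)"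
proof -
  define g where "g x = (\<Sum>y\<in>W ` J. f y * indicator {y} x)" for x
  have g: "g x = (if x \<in> W ` J then f x else 0)" for x
    using J by (auto simp: g_def indicator_def sum.delta' if_distrib cong: if_cong)
  have gm: "g \<in> borel_measurable M"
    unfolding g_def using M W by (intro borel_measurable_sum borel_measurable_times) auto
  have "(\<Sum>j\<in>J. f (W j)) / of_nat (card J) = (\<Sum>j\<in>J. g (W j)) / of_nat (card J)"
    by (simp add: g)
  also have "\<dots> = (\<integral>\<^sup>+ j. g (W j) \<partial>measure_pmf (pmf_of_set J))"
    using J by (simp add: nn_integral_pmf_of_set)
  also have "\<dots> = (\<integral>\<^sup>+ x. g x \<partial>distr (measure_pmf (pmf_of_set J)) M W)"
    using gm W by (subst nn_integral_distr) auto
  also have "\<dots> \<le> (\<integral>\<^sup>+ x. f x \<partial>distr (measure_pmf (pmf_of_set J)) M W)"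
    by (intro nn_integral_mono) (simp add: g)
  finally show ?thesis .
qed


section \<open>Planted trees\<close>

text \<open>The map (j, i) -> (j(v := i), j v) is an involution on the pairs with i \<noteq> j v,
  and each j has k - 1 such partners.\<close>

lemma sum_PiE_resample:
  fixes F :: "('a \<Rightarrow> nat) \<Rightarrow> real" and k :: nat
  assumes "finite S" and v: "v \<in> S"
  shows "(\<Sum>j\<in>Pi\<^sub>E S (\<lambda>_. {..<k}). \<Sum>i\<in>{..<k} - {j v}. F (j(v := i)))
    = real (k - 1) * (\<Sum>j\<in>Pi\<^sub>E S (\<lambda>_. {..<k}). F j)"
proof -
  define J where "J = Pi\<^sub>E S (\<lambda>_. {..<k})"
  have J: "finite J" unfolding J_def using assms by (intro finite_PiE) auto
  have "(\<Sum>j\<in>J. \<Sum>i\<in>{..<k} - {j v}. F (j(v := i)))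
      = (\<Sum>(j, i)\<in>(SIGMA j:J. {..<k} - {j v}). F (j(v := i)))"
    using J by (subst sum.Sigma) auto
  also have "\<dots> = (\<Sum>(j, i)\<in>(SIGMA j:J. {..<k} - {j v}). F j)"
    by (rule sum.reindex_bij_witness[of _ "\<lambda>(j, i). (j(v := i), j v)" "\<lambda>(j, i). (j(v := i), j v)"])
       (use v in \<open>auto simp: J_def PiE_def extensional_def Pi_def split: if_splits\<close>)
  also have "\<dots> = (\<Sum>j\<in>J. \<Sum>i\<in>{..<k} - {j v}. F j)"
    using J by (subst sum.Sigma) auto
  also have "\<dots> = (\<Sum>j\<in>J. real (k - 1) * F j)"
  proof (intro sum.cong refl)
    fix j assume "j \<in> J"
    then have "j v \<in> {..<k}" using v unfolding J_def by (rule PiE_mem)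
    then show "(\<Sum>i\<in>{..<k} - {j v}. F j) = real (k - 1) * F j" by simp
  qed
  finally show ?thesis by (simp add: sum_distrib_left J_def)
qed

text \<open>
  The core \<open>{..<k}\<close> carries a star centred at \<open>0\<close>; every other vertex is joined to all of the core
  and \<open>j\<close> selects its planted neighbour there. The remaining edges of \<open>E\<close> are arbitrary.
\<close>

locale planted_tree =
  fixes n k :: nat and E :: "nat set set" and L :: real
  assumes k: "2 \<le> k" "k \<le> n"
    and E: "E \<subseteq> {e. e \<subseteq> {..<n} \<and> card e = 2}"
    and core_edge: "\<And>u. 0 < u \<Longrightarrow> u < k \<Longrightarrow> {u, 0} \<in> E"
    and cross_edge: "\<And>v u. k \<le> v \<Longrightarrow> v < n \<Longrightarrow> u < k \<Longrightarrow> {v, u} \<in> E"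
    and L: "0 \<le> L"
begin

definition choices :: "(nat \<Rightarrow> nat) set" where
  "choices = Pi\<^sub>E {k..<n} (\<lambda>_. {..<k})"

definition tree :: "(nat \<Rightarrow> nat) \<Rightarrow> nat set set" where
  "tree j = parent_edges n (\<lambda>v. if v < k then 0 else j v)"

definition weight :: "(nat \<Rightarrow> nat) \<Rightarrow> nat set \<Rightarrow> real" where
  "weight j = (\<lambda>e\<in>E. if e \<in> tree j then 0 else L)"

text \<open>Requiring {v, i} to be the only edge of \<open>T\<close> at \<open>v\<close>, not merely
  an edge of \<open>T\<close>, makes these events disjoint for different \<open>i\<close>.\<close>

definition recovers :: "nat \<Rightarrow> nat \<Rightarrow> nat set set set" where
  "recovers v i = {T. {e\<in>T. v \<in> e} = {{v, i}}}"

definition weight_dist :: "(nat set \<Rightarrow> real) measure" where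
  "weight_dist = distr (measure_pmf (pmf_of_set choices)) (weight_space E) weight"

section \<open>Planted instances: trees, sensitivity and cost\<close>

lemma finite_E: "finite E"
  using E by (rule finite_subset[OF order_trans[of _ _ "Pow {..<n}"]]) auto

lemma choices_less: "j \<in> choices \<Longrightarrow> k \<le> v \<Longrightarrow> v < n \<Longrightarrow> j v < k"
  by (auto simp: choices_def PiE_def)

lemma finite_choices: "finite choices" "choices \<noteq> {}"
  using k by (auto simp: choices_def PiE_eq_empty_iff lessThan_empty_iff intro!: finite_PiE)

lemma spanning_tree_tree:
  assumes "j \<in> choices"
  shows "spanning_tree {..<n} E (tree j)"
  unfolding tree_def
proof (rule parent_edges_spanning_tree)
  show "(if v < k then 0 else j v) < v" if "0 < v" "v < n" for v
    using that choices_less[OF assms, of v] k by auto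
  show "parent_edges n (\<lambda>v. if v < k then 0 else j v) \<subseteq> E"
    using choices_less[OF assms] core_edge cross_edge by (auto simp: parent_edges_def)
qed

lemma graph_topology_E: "graph_topology {..<n} E"
proof -
  obtain j where j: "j \<in> choices" using finite_choices(2) by blast
  have "connects {..<n} E"
    using spanning_tree_tree[OF j] connects_mono by (auto simp: spanning_tree_def)
  then show ?thesis using E k by (auto simp: graph_topology_def lessThan_empty_iff)
qed

text \<open>An outer vertex is a leaf of the planted tree: all parents lie in the core.\<close>

lemma tree_edge_unique:
  assumes "j \<in> choices" "k \<le> v" "e \<in> tree j" "v \<in> e"
  shows "e = {v, j v}"
proof -
  obtain u where u: "0 < u" "u < n" "e = {u, if u < k then 0 else j u}"
    using assms(3) by (auto simp: tree_def parent_edges_def)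
  then show ?thesis using assms choices_less[OF assms(1), of u] k by (auto split: if_splits)
qed

lemma weight_in_space: "weight j \<in> space (weight_space E)"
  by (auto simp: weight_def space_PiM)

lemma weight_nonneg: "e \<in> E \<Longrightarrow> 0 \<le> weight j e"
  using L by (auto simp: weight_def)

text \<open>Only {v, i} and {v, j v} can enter or leave the planted tree, and each changes its
  weight by at most \<open>L\<close>.\<close>

lemma weight_resample_le:
  assumes j: "j \<in> choices" and v: "k \<le> v" "v < n" "i < k"
  shows "(\<Sum>e\<in>E. \<bar>weight (j(v := i)) e - weight j e\<bar>) \<le> 2 * L"
proof -
  \<comment> \<open>Stated for free \<open>h\<close> and \<open>h'\<close> so that it gives both
    directions of the comparison below.\<close>
  have tree: "e \<in> tree h'" if e: "e \<in> tree h" "e \<noteq> {v, h v}" and h: "\<And>u. u \<noteq> v \<Longrightarrow> h u = h' u"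
    for e h h'
  proof -
    obtain u where u: "u \<in> {0<..<n}" "e = {u, if u < k then 0 else h u}"
      using e(1) unfolding tree_def parent_edges_def by (rule imageE)
    then have "u \<noteq> v" using e(2) v(1) by auto
    with u have "e = {u, if u < k then 0 else h' u}" by (simp add: h)
    then show ?thesis unfolding tree_def parent_edges_def using u(1) by (rule image_eqI)
  qed
  have same: "weight (j(v := i)) e = weight j e" if "e \<in> E - {{v, i}, {v, j v}}" for e
  proof -
    have "e \<in> tree (j(v := i)) \<longleftrightarrow> e \<in> tree j"
      using that tree[of e j "j(v := i)"] tree[of e "j(v := i)" j] by auto
    then show ?thesis by (simp add: weight_def)
  qed
  have "(\<Sum>e\<in>E. \<bar>weight (j(v := i)) e - weight j e\<bar>)
      = (\<Sum>e\<in>{{v, i}, {v, j v}} \<inter> E. \<bar>weight (j(v := i)) e - weight j e\<bar>)"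
    using finite_E same by (intro sum.mono_neutral_right) auto
  also have "\<dots> \<le> (\<Sum>e\<in>{{v, i}, {v, j v}} \<inter> E. L)"
    using L by (intro sum_mono) (auto simp: weight_def)
  also have "\<dots> = real (card ({{v, i}, {v, j v}} \<inter> E)) * L" by simp
  also have "card ({{v, i}, {v, j v}} \<inter> E) \<le> card {{v, i}, {v, j v}}" by (intro card_mono) auto
  also have "card {{v, i}, {v, j v}} \<le> 2" by (simp add: card_insert_if)
  finally show ?thesis using L by (simp add: mult_right_mono)
qed

text \<open>The planted tree is a competitor of weight 0, and the minimum is attained because there
  are finitely many spanning trees.\<close>

lemma sum_weight_min_spanning_tree:
  assumes "j \<in> choices"
  shows "sum (weight j) (min_spanning_tree {..<n} E (weight j)) \<le> 0"
proof -
  have "finite {T. spanning_tree {..<n} E T}"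
    by (rule finite_subset[of _ "Pow E"]) (use finite_E in \<open>auto simp: spanning_tree_def\<close>)
  then have "sum (weight j) (min_spanning_tree {..<n} E (weight j)) \<le> sum (weight j) (tree j)"
    unfolding min_spanning_tree_def
    by (rule arg_min_least) (use spanning_tree_tree[OF assms] in auto)
  also have "\<dots> = 0"
    using spanning_tree_tree[OF assms] by (intro sum.neutral) (auto simp: weight_def spanning_tree_def)
  finally show ?thesis .
qed

text \<open>
  A vertex outside the core that is not recovered is incident to an unplanted edge of \<open>T\<close>,
  and an edge is charged at most twice.
\<close>

lemma sum_weight_ge_unrecovered:
  assumes j: "j \<in> choices" and T: "spanning_tree {..<n} E T"
  shows "L / 2 * (\<Sum>v=k..<n. indicator (- recovers v (j v)) T) \<le> sum (weight j) T"
proof -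
  have TE: "T \<subseteq> E" and con: "connects {..<n} T" using T by (auto simp: spanning_tree_def)
  have fT: "finite T" using TE finite_E finite_subset by blast
  have "L * (\<Sum>v=k..<n. indicator (- recovers v (j v)) T)
      \<le> (\<Sum>v=k..<n. \<Sum>e\<in>T. if v \<in> e then weight j e else 0)"
    unfolding sum_distrib_left
  proof (intro sum_mono)
    fix v assume v: "v \<in> {k..<n}"
    have nonneg: "0 \<le> (if v \<in> e then weight j e else 0)" if "e \<in> T" for e
      using that TE weight_nonneg by auto
    show "L * indicator (- recovers v (j v)) T \<le> (\<Sum>e\<in>T. if v \<in> e then weight j e else 0)"
    proof (cases "T \<in> recovers v (j v)")
      case True
      then show ?thesis using nonneg by (simp add: sum_nonneg)
    next
      case False
      \<comment> \<open>Connectedness gives some edge at \<open>v\<close>, since \<open>v\<close>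
        differs from \<open>0\<close>. So failing to recover means that \<open>T\<close> has an edge
        at \<open>v\<close> other than the planted one.\<close>
      obtain f where "f \<in> T" "v \<in> f"
        using connects_incident_edge[OF con, of v 0] v k by auto
      with False obtain e where e: "e \<in> T" "v \<in> e" "e \<noteq> {v, j v}"
        by (auto simp: recovers_def)
      then have "weight j e = L"
        using tree_edge_unique[OF j, of v e] v TE by (auto simp: weight_def)
      moreover have "(if v \<in> e then weight j e else 0) \<le> (\<Sum>e\<in>T. if v \<in> e then weight j e else 0)"
        using nonneg fT e(1) by (intro member_le_sum) auto
      ultimately show ?thesis using False e by simp
    qed
  qed
  also have "\<dots> = (\<Sum>e\<in>T. \<Sum>v=k..<n. if v \<in> e then weight j e else 0)" by (rule sum.swap)
  also have "\<dots> \<le> (\<Sum>e\<in>T. 2 * weight j e)"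
  proof (intro sum_mono)
    fix e assume e: "e \<in> T"
    have ce: "card e = 2" using e TE E by auto
    then have "finite e" by (intro card_ge_0_finite) simp
    then have "card ({k..<n} \<inter> e) \<le> 2" using card_mono[of e "{k..<n} \<inter> e"] ce by auto
    moreover have "(\<Sum>v=k..<n. if v \<in> e then weight j e else 0) = real (card ({k..<n} \<inter> e)) * weight j e"
      by (simp add: sum.inter_restrict[symmetric])
    ultimately show "(\<Sum>v=k..<n. if v \<in> e then weight j e else 0) \<le> 2 * weight j e"
      using weight_nonneg[of e j] e TE by (auto intro!: mult_right_mono)
  qed
  also have "\<dots> = 2 * sum (weight j) T" by (simp add: sum_distrib_left)
  finally show ?thesis by simp
qed

section \<open>Privacy prevents recovery of the planted edges\<close>

lemma sum_prob_recovers_le_1: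
  "(\<Sum>i<k. measure_pmf.prob q (recovers v i)) \<le> 1"
proof -
  have "disjoint_family_on (recovers v) {..<k}"
    by (auto simp: disjoint_family_on_def recovers_def doubleton_eq_iff)
  then have "(\<Sum>i<k. measure_pmf.prob q (recovers v i)) = measure_pmf.prob q (\<Union>i<k. recovers v i)"
    by (intro measure_pmf.finite_measure_finite_Union[symmetric]) auto
  then show ?thesis by simp
qed

text \<open>
  Resampling \<open>j v\<close> is reversible, so a private algorithm that recovers the planted neighbour of
  \<open>v\<close> often also outputs each of the other \<open>k - 1\<close> neighbours often.
\<close>

lemma unrecovered_ge:
  assumes dp: "differentially_private \<epsilon> \<delta> E A" and r: "0 < r" "2 * L \<le> real r"
    and v: "v \<in> {k..<n}"
    and d: "d = \<delta> * (\<Sum>i<r. exp (\<epsilon> * real i))" and a: "a = exp (\<epsilon> * real r) / real (k - 1)"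
  shows "real (card choices) * ((1 - d) / (1 + a))
    \<le> (\<Sum>j\<in>choices. measure_pmf.prob (A (weight j)) (- recovers v (j v)))"
proof -
  define K where "K = real (k - 1)"
  have K: "0 < K" using k by (simp add: K_def)
  define G where "G j i = measure_pmf.prob (A (weight j)) (recovers v i)" for j i
  define P where "P = (\<Sum>j\<in>choices. G j (j v))"
  \<comment> \<open>Recovery is written at the resampled instances, so that group privacy can move
    all of them to the one instance \<open>weight j\<close>, where the events for different
    \<open>i\<close> share total probability at most 1.\<close>
  have "K * P = (\<Sum>j\<in>choices. \<Sum>i\<in>{..<k} - {j v}. G (j(v := i)) i)"
    using sum_PiE_resample[OF _ v, of "\<lambda>j. G j (j v)"]
    by (simp add: P_def K_def choices_def)
  also have "\<dots> \<le> (\<Sum>j\<in>choices. exp (\<epsilon> * real r) * (1 - G j (j v)) + K * d)"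
  proof (intro sum_mono)
    fix j assume j: "j \<in> choices"
    then have jv: "j v \<in> {..<k}" using v choices_less by auto
    have "(\<Sum>i\<in>{..<k} - {j v}. G (j(v := i)) i)
        \<le> (\<Sum>i\<in>{..<k} - {j v}. exp (\<epsilon> * real r) * G j i + d)"
    proof (rule sum_mono)
      fix i assume "i \<in> {..<k} - {j v}"
      then have "(\<Sum>e\<in>E. \<bar>weight (j(v := i)) e - weight j e\<bar>) \<le> 2 * L"
        using v by (intro weight_resample_le[OF j]) auto
      then have "(\<Sum>e\<in>E. \<bar>weight (j(v := i)) e - weight j e\<bar>) \<le> real r" using r(2) by linarith
      then show "G (j(v := i)) i \<le> exp (\<epsilon> * real r) * G j i + d"
        unfolding G_def d by (rule group_privacy[OF dp weight_in_space weight_in_space r(1)])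
    qed
    also have "\<dots> = exp (\<epsilon> * real r) * (\<Sum>i\<in>{..<k} - {j v}. G j i) + K * d"
      using jv by (simp add: sum.distrib sum_distrib_left K_def)
    also have "\<dots> \<le> exp (\<epsilon> * real r) * (1 - G j (j v)) + K * d"
    proof -
      have "(\<Sum>i<k. G j i) \<le> 1" unfolding G_def by (rule sum_prob_recovers_le_1)
      then have "(\<Sum>i\<in>{..<k} - {j v}. G j i) \<le> 1 - G j (j v)"
        using jv by (simp add: sum_diff1)
      then show ?thesis by simp
    qed
    finally show "(\<Sum>i\<in>{..<k} - {j v}. G (j(v := i)) i)
        \<le> exp (\<epsilon> * real r) * (1 - G j (j v)) + K * d" .
  qed
  also have "\<dots> = exp (\<epsilon> * real r) * (real (card choices) - P) + real (card choices) * (K * d)"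
    by (simp add: sum.distrib sum_distrib_left[symmetric] sum_subtractf P_def)
  finally have KP: "K * P \<le> exp (\<epsilon> * real r) * (real (card choices) - P)
      + real (card choices) * (K * d)" .
  have "P = K * P / K" using K by simp
  also have "\<dots> \<le> (exp (\<epsilon> * real r) * (real (card choices) - P)
      + real (card choices) * (K * d)) / K"
    using KP K by (intro divide_right_mono) auto
  also have "\<dots> = a * (real (card choices) - P) + real (card choices) * d"
    using K unfolding a K_def[symmetric] by (simp add: add_divide_distrib)
  \<comment> \<open>For the average p of the recovery probabilities this is p \<le> a (1 - p) + d,
    solved for 1 - p.\<close>
  finally have "real (card choices) * (1 - d) \<le> (real (card choices) - P) * (1 + a)"
    by (simp add: algebra_simps)
  moreover have "0 < 1 + a" unfolding a by (intro add_pos_nonneg) auto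
  ultimately have "real (card choices) * ((1 - d) / (1 + a)) \<le> real (card choices) - P"
    by (simp add: pos_divide_le_eq)
  also have "\<dots> = (\<Sum>j\<in>choices. measure_pmf.prob (A (weight j)) (- recovers v (j v)))"
    by (simp add: prob_pmf_Compl P_def G_def sum_subtractf)
  finally show ?thesis .
qed

text \<open>For fixed \<open>j\<close> the excess weight is at least L / 2 per unrecovered outer
  vertex. Average over \<open>j\<close>, exchange the sums and apply the privacy bound at each of
  the n - k outer vertices.\<close>

lemma expected_error_ge:
  assumes dp: "differentially_private \<epsilon> \<delta> E A" and out: "outputs_spanning_tree {..<n} E A"
    and r: "0 < r" "2 * L \<le> real r"
    and d: "d = \<delta> * (\<Sum>i<r. exp (\<epsilon> * real i))" and a: "a = exp (\<epsilon> * real r) / real (k - 1)"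
  shows "ennreal (L / 2 * real (n - k) * ((1 - d) / (1 + a)))
    \<le> expected_error {..<n} E weight_dist A"
proof -
  define b where "b j v = measure_pmf.prob (A (weight j)) (- recovers v (j v))" for j v
  define err where "err w = (\<integral>\<^sup>+ T. ennreal (sum w T - sum w (min_spanning_tree {..<n} E w))
    \<partial>measure_pmf (A w))" for w
  have err: "ennreal (L / 2 * (\<Sum>v=k..<n. b j v)) \<le> err (weight j)" if j: "j \<in> choices" for j
  proof -
    define g where "g T = L / 2 * (\<Sum>v=k..<n. indicator (- recovers v (j v)) T)" for T
    have g: "has_bochner_integral (measure_pmf (A (weight j))) g (L / 2 * (\<Sum>v=k..<n. b j v))"
      unfolding g_def b_def
      by (intro has_bochner_integral_mult_right has_bochner_integral_sum)
         (simp add: has_bochner_integral_iff integrable_pmf_indicator)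
    have "ennreal (L / 2 * (\<Sum>v=k..<n. b j v)) = (\<integral>\<^sup>+ T. ennreal (g T) \<partial>measure_pmf (A (weight j)))"
    proof -
      have "0 \<le> g T" for T
        using L unfolding g_def by (intro mult_nonneg_nonneg sum_nonneg) auto
      then have "(\<integral>\<^sup>+ T. ennreal (g T) \<partial>measure_pmf (A (weight j)))
          = ennreal (\<integral>T. g T \<partial>measure_pmf (A (weight j)))"
        using g by (intro nn_integral_eq_integral) (auto simp: has_bochner_integral_iff)
      then show ?thesis by (simp only: has_bochner_integral_integral_eq[OF g])
    qed
    also have "\<dots> \<le> err (weight j)"
      unfolding err_def
    proof (intro nn_integral_mono_AE AE_pmfI ennreal_leI)
      fix T assume "T \<in> set_pmf (A (weight j))"
      then have "spanning_tree {..<n} E T"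
        using out weight_in_space by (auto simp: outputs_spanning_tree_def)
      from sum_weight_ge_unrecovered[OF j this] sum_weight_min_spanning_tree[OF j]
      show "g T \<le> sum (weight j) T - sum (weight j) (min_spanning_tree {..<n} E (weight j))"
        by (simp add: g_def)
    qed
    finally show ?thesis .
  qed
  define N where "N = real (card choices)"
  define y where "y = (1 - d) / (1 + a)"
  have N: "0 < N" using finite_choices by (simp add: N_def card_gt_0_iff)
  have "L / 2 * real (n - k) * (N * y) = L / 2 * (\<Sum>v=k..<n. N * y)" by simp
  also have "\<dots> \<le> L / 2 * (\<Sum>v=k..<n. \<Sum>j\<in>choices. b j v)"
    using L unfolding b_def N_def y_def
    by (intro mult_left_mono sum_mono unrecovered_ge[OF dp r _ d a]) auto
  also have "\<dots> = (\<Sum>j\<in>choices. L / 2 * (\<Sum>v=k..<n. b j v))"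
    unfolding sum_distrib_left by (rule sum.swap)
  finally have "L / 2 * real (n - k) * y \<le> (\<Sum>j\<in>choices. L / 2 * (\<Sum>v=k..<n. b j v)) / N"
    using N by (simp add: pos_le_divide_eq mult_ac)
  then have "ennreal (L / 2 * real (n - k) * y)
      \<le> ennreal ((\<Sum>j\<in>choices. L / 2 * (\<Sum>v=k..<n. b j v)) / N)" by (rule ennreal_leI)
  also have "\<dots> = (\<Sum>j\<in>choices. ennreal (L / 2 * (\<Sum>v=k..<n. b j v))) / ennreal N"
  proof -
    have pos: "0 \<le> L / 2 * (\<Sum>v=k..<n. b j v)" for j
      using L by (intro mult_nonneg_nonneg sum_nonneg) (auto simp: b_def)
    then have "0 \<le> (\<Sum>j\<in>choices. L / 2 * (\<Sum>v=k..<n. b j v))" by (intro sum_nonneg)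
    then show ?thesis using N pos by (simp only: sum_ennreal divide_ennreal)
  qed
  also have "\<dots> = (\<Sum>j\<in>choices. ennreal (L / 2 * (\<Sum>v=k..<n. b j v))) / of_nat (card choices)"
    by (simp add: N_def ennreal_of_nat_eq_real_of_nat)
  also have "\<dots> \<le> (\<Sum>j\<in>choices. err (weight j)) / of_nat (card choices)"
    by (intro divide_right_mono_ennreal sum_mono err)
  also have "\<dots> \<le> (\<integral>\<^sup>+ w. err w \<partial>weight_dist)"
    unfolding weight_dist_def
    by (intro nn_integral_distr_pmf_of_set_ge finite_choices weight_in_space
        singleton_in_sets_weight_space finite_E)
  finally show ?thesis unfolding expected_error_def err_def y_def .
qed

end


section \<open>Choice of the parameters\<close>

lemma eventually_private_scale:
  fixes \<epsilon> \<gamma> :: real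
  assumes "\<epsilon> > 0" and "\<gamma> > 0"
  obtains \<beta> x\<^sub>0 :: real where "0 < \<beta>" "4 \<le> x\<^sub>0"
    "\<And>x r \<delta>. x\<^sub>0 \<le> x \<Longrightarrow> r = nat \<lfloor>\<beta> * ln x\<rfloor> \<Longrightarrow> 0 \<le> \<delta> \<Longrightarrow> \<delta> \<le> x powr (- \<gamma>) \<Longrightarrow>
       0 < r \<and> \<beta> * ln x / 2 \<le> real r \<and> exp (\<epsilon> * real r) \<le> x / 2
       \<and> \<delta> * (\<Sum>i<r. exp (\<epsilon> * real i)) \<le> 1 / 2"
proof -
  \<comment> \<open>This makes exp (\<epsilon> r) at most x^(1/2), to be beaten by the core size,
    and at most x^(\<gamma>/2), to be beaten by \<delta>.\<close>
  define \<beta> where "\<beta> = min 1 \<gamma> / (2 * \<epsilon>)"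
  have \<beta>: "0 < \<beta>" using assms by (simp add: \<beta>_def)
  have "((\<lambda>x. x powr (- (\<gamma> / 2)) * (\<beta> * ln x)) \<longlongrightarrow> 0) at_top"
    using assms(2) by real_asymp
  then have "eventually (\<lambda>x. x powr (- (\<gamma> / 2)) * (\<beta> * ln x) < 1 / 2) at_top"
    by (rule order_tendstoD) simp
  moreover have "eventually (\<lambda>x. 1 \<le> \<beta> * ln x) at_top"
    using \<beta> by real_asymp
  ultimately have "eventually (\<lambda>x. x powr (- (\<gamma> / 2)) * (\<beta> * ln x) < 1 / 2 \<and> 1 \<le> \<beta> * ln x) at_top"
    by (rule eventually_conj)
  then obtain x\<^sub>1 where x\<^sub>1: "\<And>x. x\<^sub>1 \<le> x \<Longrightarrow> x powr (- (\<gamma> / 2)) * (\<beta> * ln x) < 1 / 2"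
    "\<And>x. x\<^sub>1 \<le> x \<Longrightarrow> 1 \<le> \<beta> * ln x"
    by (auto simp: eventually_at_top_linorder)
  show thesis
  \<comment> \<open>From 4 on, the square root of x is at most x / 2.\<close>
  proof (rule that[of \<beta> "max 4 x\<^sub>1"])
    fix x \<delta> :: real and r :: nat
    assume x: "max 4 x\<^sub>1 \<le> x" and r: "r = nat \<lfloor>\<beta> * ln x\<rfloor>" and \<delta>: "0 \<le> \<delta>" "\<delta> \<le> x powr (- \<gamma>)"
    have y: "1 \<le> \<beta> * ln x" using x\<^sub>1(2) x by simp
    then have r1: "1 \<le> r" using r by (simp add: le_nat_iff le_floor_iff)
    \<comment> \<open>The floor loses less than 1; together with r \<ge> 1 this loses at most a
      factor 2.\<close>
    have rle: "real r \<le> \<beta> * ln x" and rge: "\<beta> * ln x < real r + 1"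
      using y r by linarith+
    have "\<epsilon> * real r \<le> \<epsilon> * (\<beta> * ln x)" using rle assms by simp
    then have "exp (\<epsilon> * real r) \<le> exp (\<epsilon> * (\<beta> * ln x))" by simp
    also have "\<dots> = x powr (min 1 \<gamma> / 2)" using x assms by (simp add: powr_def \<beta>_def)
    finally have er: "exp (\<epsilon> * real r) \<le> x powr (min 1 \<gamma> / 2)" .
    have "x powr (min 1 \<gamma> / 2) \<le> x powr (1 / 2)" using x by (intro powr_mono) auto
    also have "\<dots> = sqrt x" using x by (simp add: powr_half_sqrt)
    also have "\<dots> \<le> x / 2"
    proof (rule real_le_lsqrt)
      have "4 * x \<le> x * x" using x by (intro mult_right_mono) auto
      then show "x \<le> (x / 2)\<^sup>2" by (simp add: power2_eq_square)
    qed (use x in auto)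
    finally have exr: "exp (\<epsilon> * real r) \<le> x / 2" using er by linarith
    \<comment> \<open>Bounding every term by exp (\<epsilon> r) costs only a logarithmic factor,
      which x^(-\<gamma>/2) absorbs.\<close>
    have "(\<Sum>i<r. exp (\<epsilon> * real i)) \<le> (\<Sum>i<r. exp (\<epsilon> * real r))"
      using assms by (intro sum_mono) simp
    also have "\<dots> = real r * exp (\<epsilon> * real r)" by simp
    also have "\<dots> \<le> \<beta> * ln x * x powr (\<gamma> / 2)"
    proof (intro mult_mono rle order_trans[OF er])
      show "x powr (min 1 \<gamma> / 2) \<le> x powr (\<gamma> / 2)" using x by (intro powr_mono) auto
    qed (use y in auto)
    finally have "\<delta> * (\<Sum>i<r. exp (\<epsilon> * real i)) \<le> x powr (- \<gamma>) * (\<beta> * ln x * x powr (\<gamma> / 2))"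
      using \<delta> by (intro mult_mono) (auto intro: sum_nonneg)
    also have "\<dots> = x powr (- \<gamma> + \<gamma> / 2) * (\<beta> * ln x)" by (simp only: powr_add) (simp add: mult_ac)
    also have "- \<gamma> + \<gamma> / 2 = - (\<gamma> / 2)" by simp
    also have "x powr (- (\<gamma> / 2)) * (\<beta> * ln x) < 1 / 2" using x\<^sub>1(1) x by simp
    finally have "\<delta> * (\<Sum>i<r. exp (\<epsilon> * real i)) \<le> 1 / 2" by simp
    then show "0 < r \<and> \<beta> * ln x / 2 \<le> real r \<and> exp (\<epsilon> * real r) \<le> x / 2
       \<and> \<delta> * (\<Sum>i<r. exp (\<epsilon> * real i)) \<le> 1 / 2"
      using r1 rge exr by auto
  qed (use \<beta> in auto)
qed

text \<open>The required star and cross edges number at most k n \<le> m, so they can be padded with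
  arbitrary further edges to exactly \<open>m\<close>.\<close>

lemma planted_tree_exists:
  assumes k: "2 \<le> k" "k \<le> n" and m: "k * n \<le> m" "m \<le> n choose 2" and L: "0 \<le> L"
  obtains E where "card E = m" "planted_tree n k E L"
proof -
  define core where "core = (\<lambda>u. {u, 0}) ` {0<..<k}"
  define cross where "cross = (\<lambda>(v, u). {v, u}) ` ({k..<n} \<times> {..<k})"
  define K where "K = {e. e \<subseteq> {..<n} \<and> card e = 2}"
  have fin: "finite K" unfolding K_def by (rule finite_subset[of _ "Pow {..<n}"]) auto
  have sub: "core \<union> cross \<subseteq> K" using k by (auto simp: core_def cross_def K_def card_insert_if)
  have "card (core \<union> cross) \<le> card core + card cross" by (rule card_Un_le)
  also have "card core \<le> k - 1" unfolding core_def
    by (rule order_trans[OF card_image_le]) auto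
  also have "card cross \<le> (n - k) * k" unfolding cross_def
    by (rule order_trans[OF card_image_le]) (auto simp: card_cartesian_product)
  also have "k - 1 + (n - k) * k \<le> m"
  proof -
    have "k - 1 \<le> k * k" using mult_le_mono1[of 1 k k] k by linarith
    then have "k - 1 + (n - k) * k \<le> k * k + (n - k) * k" by simp
    also have "\<dots> = (k + (n - k)) * k" by (rule add_mult_distrib[symmetric])
    also have "\<dots> = k * n" using k by simp
    finally show ?thesis using m by simp
  qed
  finally have "card (core \<union> cross) \<le> m" by simp
  moreover have "card K = n choose 2" unfolding K_def by (subst n_subsets) auto
  ultimately obtain E where E: "core \<union> cross \<subseteq> E" "E \<subseteq> K" "card E = m"
    using exists_subset_between[OF _ _ sub fin, of m] m by auto
  have "planted_tree n k E L"
  proof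
    show "{u, 0} \<in> E" if "0 < u" "u < k" for u using that E(1) by (auto simp: core_def)
    show "{v, u} \<in> E" if "k \<le> v" "v < n" "u < k" for v u
      using that E(1) by (force simp: cross_def)
  qed (use k L E in \<open>auto simp: K_def\<close>)
  then show thesis using that E(3) by blast
qed

theorem theorem3p1:
  fixes \<epsilon> \<gamma> :: real
  assumes "\<epsilon> > 0" and "\<gamma> > 0"
  shows "\<exists>c::real. c > 0 \<and>
    (\<forall>(n::nat) (m::nat) (\<delta>::real).
       m > 2 * n \<and> m \<le> n choose 2 \<and> 0 \<le> \<delta> \<and> \<delta> \<le> 1 \<and> \<delta> \<le> (real n / real m) powr \<gamma> \<longrightarrow>
       (\<exists>(V :: nat set) (E :: nat set set) (D :: (nat set \<Rightarrow> real) measure).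
          graph_topology V E \<and> card V = n \<and> card E = m \<and>
          prob_space D \<and> sets D = sets (weight_space E) \<and>
          (\<forall>A. differentially_private \<epsilon> \<delta> E A \<and> outputs_spanning_tree V E A \<longrightarrow>
             enn2ereal (expected_error V E D A) \<ge>
               ereal (c * (real n / \<epsilon>)) * min (ln_inverse \<delta>) (ereal (ln (real m / real n))))))"
proof -
  obtain \<beta> x\<^sub>0 where \<beta>: "0 < \<beta>" and x\<^sub>0: "4 \<le> x\<^sub>0"
    and scale: "\<And>x r \<delta>. x\<^sub>0 \<le> x \<Longrightarrow> r = nat \<lfloor>\<beta> * ln x\<rfloor> \<Longrightarrow> 0 \<le> \<delta> \<Longrightarrow> \<delta> \<le> x powr (- \<gamma>) \<Longrightarrow>
       0 < r \<and> \<beta> * ln x / 2 \<le> real r \<and> exp (\<epsilon> * real r) \<le> x / 2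
       \<and> \<delta> * (\<Sum>i<r. exp (\<epsilon> * real i)) \<le> 1 / 2"
    using eventually_private_scale[OF assms] by metis
  \<comment> \<open>Failure probability for bounded m/n: there r = 1, \<delta> \<le> 2 powr
    (-\<gamma>), and k - 1 \<ge> 1.\<close>
  define \<eta> where "\<eta> = (1 - 2 powr (- \<gamma>)) / (1 + exp \<epsilon>)"
  have "2 powr (- \<gamma>) < (1::real)" using assms powr_less_one[of 2 "- \<gamma>"] by simp
  then have \<eta>: "0 < \<eta>" by (simp add: \<eta>_def add_pos_pos)
  have lnx\<^sub>0: "0 < ln x\<^sub>0" using x\<^sub>0 by simp
  \<comment> \<open>One entry for each range of x = m/n: the first serves below
    \<open>x\<^sub>0\<close>, where ln x is at most \<open>ln x\<^sub>0\<close>; the second serves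
    above, where r / 8 * (1 / 4) \<ge> \<beta> ln x / 64.\<close>
  define c where "c = \<epsilon> * min (\<eta> / (8 * ln x\<^sub>0)) (\<beta> / 64)"
  have c: "0 < c" using assms \<beta> \<eta> lnx\<^sub>0 by (simp add: c_def)
  show ?thesis
  proof (intro exI[of _ c] conjI c allI impI)
    fix n m :: nat and \<delta> :: real
    assume H: "m > 2 * n \<and> m \<le> n choose 2 \<and> 0 \<le> \<delta> \<and> \<delta> \<le> 1 \<and> \<delta> \<le> (real n / real m) powr \<gamma>"
    define x where "x = real m / real n"
    define k where "k = m div n"
    have n: "0 < n" using H by (cases n) (auto simp: binomial_eq_0)
    have x2: "2 < x" using H n by (simp add: x_def field_simps)
    have k2: "2 \<le> k" using H n by (simp add: k_def less_eq_div_iff_mult_less_eq)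
    have kn: "k * n \<le> m" by (simp add: k_def)
    \<comment> \<open>The number of available edges forces 2 k \<le> n - 1, so at least half of the
      vertices lie outside the core.\<close>
    have "m \<le> n * (n - 1) div 2" using H by (simp add: choose_two)
    then have "2 * m \<le> n * (n - 1)" by linarith
    moreover have "2 * (k * n) = n * (2 * k)" by simp
    ultimately have "n * (2 * k) \<le> n * (n - 1)" using kn by linarith
    then have kn2: "2 * k \<le> n - 1" using n by (simp only: nat_mult_le_cancel_disj)
    have half: "real n / 2 \<le> real (n - k)" and k: "k \<le> n" using kn2 by linarith+
    have "m < (k + 1) * n" using n by (simp add: k_def mult.commute dividend_less_times_div)
    then have "real m < (real k + 1) * real n" by (metis of_nat_1 of_nat_add of_nat_less_iff of_nat_mult)
    then have xk: "x < real k + 1" using n by (simp add: x_def field_simps)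
    have \<delta>: "0 \<le> \<delta>" "\<delta> \<le> x powr (- \<gamma>)"
      using H n by (auto simp: x_def powr_minus powr_divide field_simps)
    \<comment> \<open>\<open>q\<close> bounds the average failure probability from below. The edge
      weight will be L = r / 2, and L / 2 times n / 2 outer vertices gives the factor r / 8 per
      vertex.\<close>
    obtain r :: nat and q :: real where r: "0 < r"
      and q: "q \<le> (1 - \<delta> * (\<Sum>i<r. exp (\<epsilon> * real i))) / (1 + exp (\<epsilon> * real r) / real (k - 1))"
      and bound: "c / \<epsilon> * ln x \<le> real r / 8 * q" "0 \<le> q"
    proof (cases "x\<^sub>0 \<le> x")
      case True
      define r where "r = nat \<lfloor>\<beta> * ln x\<rfloor>"
      note s = scale[OF True r_def \<delta>]
      show thesis
      proof (rule that[of r "1 / 4"])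
        \<comment> \<open>Here k - 1 > x - 2, which is at least x / 2 since x \<ge> 4.\<close>
        have "x / 2 \<le> real (k - 1)" using xk x\<^sub>0 True by linarith
        then have "exp (\<epsilon> * real r) \<le> real (k - 1)" using s by linarith
        then have a: "exp (\<epsilon> * real r) / real (k - 1) \<le> 1" using k2 by simp
        have "1 / 4 = (1 / 2) / (1 + 1 :: real)" by simp
        also have "\<dots> \<le> (1 - \<delta> * (\<Sum>i<r. exp (\<epsilon> * real i))) / (1 + exp (\<epsilon> * real r) / real (k - 1))"
          using s a by (intro frac_le) (auto intro: add_pos_nonneg)
        finally show "1 / 4 \<le> (1 - \<delta> * (\<Sum>i<r. exp (\<epsilon> * real i))) / (1 + exp (\<epsilon> * real r) / real (k - 1))" .
        have "c / \<epsilon> \<le> \<beta> / 64" using assms by (simp add: c_def)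
        then have "c / \<epsilon> * ln x \<le> \<beta> / 64 * ln x" using x2 by (intro mult_right_mono) auto
        also have "\<dots> \<le> real r / 8 * (1 / 4)" using s by simp
        finally show "c / \<epsilon> * ln x \<le> real r / 8 * (1 / 4)" .
      qed (use s in auto)
    next
      case False
      show thesis
      proof (rule that[of 1 \<eta>])
        have "exp \<epsilon> / real (k - 1) \<le> exp \<epsilon> / 1" using k2 by (intro divide_left_mono) auto
        moreover have "x powr (- \<gamma>) \<le> 2 powr (- \<gamma>)" using x2 assms by (intro powr_mono2') auto
        ultimately show "\<eta> \<le> (1 - \<delta> * (\<Sum>i<1. exp (\<epsilon> * real i))) / (1 + exp (\<epsilon> * real 1) / real (k - 1))"
          unfolding \<eta>_def using \<delta> \<open>2 powr (- \<gamma>) < 1\<close> by (intro frac_le) (auto intro: add_pos_nonneg)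
        have "c / \<epsilon> \<le> \<eta> / (8 * ln x\<^sub>0)" using assms by (simp add: c_def)
        then have "c / \<epsilon> * ln x \<le> \<eta> / (8 * ln x\<^sub>0) * ln x\<^sub>0"
          using x2 False lnx\<^sub>0 \<eta> c assms by (intro mult_mono) auto
        then show "c / \<epsilon> * ln x \<le> real 1 / 8 * \<eta>" using lnx\<^sub>0 by simp
      qed (use \<eta> in auto)
    qed
    obtain E where cE: "card E = m" and pt: "planted_tree n k E (real r / 2)"
      using planted_tree_exists[OF k2 k kn] H by (metis of_nat_0_le_iff divide_nonneg_nonneg zero_le_numeral)
    interpret planted_tree n k E "real r / 2" by (rule pt)
    show "\<exists>(V :: nat set) (E :: nat set set) (D :: (nat set \<Rightarrow> real) measure).
          graph_topology V E \<and> card V = n \<and> card E = m \<and>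
          prob_space D \<and> sets D = sets (weight_space E) \<and>
          (\<forall>A. differentially_private \<epsilon> \<delta> E A \<and> outputs_spanning_tree V E A \<longrightarrow>
             enn2ereal (expected_error V E D A) \<ge>
               ereal (c * (real n / \<epsilon>)) * min (ln_inverse \<delta>) (ereal (ln (real m / real n))))"
    proof (intro exI conjI allI impI)
      show "graph_topology {..<n} E" by (rule graph_topology_E)
      show "prob_space weight_dist" unfolding weight_dist_def
        using weight_in_space by (intro measure_pmf.prob_space_distr) auto
      show "sets weight_dist = sets (weight_space E)" by (simp add: weight_dist_def)
      fix A assume A: "differentially_private \<epsilon> \<delta> E A \<and> outputs_spanning_tree {..<n} E A"
      have "c * (real n / \<epsilon>) * ln x = real n * (c / \<epsilon> * ln x)" by simp
      also have "\<dots> \<le> real n * (real r / 8 * q)" using bound by (intro mult_left_mono) auto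
      also have "\<dots> = (real r / 2) / 2 * (real n / 2) * q" by simp
      also have "\<dots> \<le> (real r / 2) / 2 * real (n - k)
          * ((1 - \<delta> * (\<Sum>i<r. exp (\<epsilon> * real i))) / (1 + exp (\<epsilon> * real r) / real (k - 1)))"
        using half q bound(2) by (intro mult_mono) auto
      finally have "ennreal (c * (real n / \<epsilon>) * ln x) \<le> expected_error {..<n} E weight_dist A"
        using expected_error_ge[OF _ _ r _ refl refl, of \<epsilon> \<delta> A] A
        by (auto intro: order_trans[OF ennreal_leI])
      then have "enn2ereal (ennreal (c * (real n / \<epsilon>) * ln x))
          \<le> enn2ereal (expected_error {..<n} E weight_dist A)"
        by (simp add: less_eq_ennreal.rep_eq)
      moreover have "0 \<le> c * (real n / \<epsilon>) * ln x" using c assms x2 by simp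
      ultimately have "ereal (c * (real n / \<epsilon>) * ln x) \<le> enn2ereal (expected_error {..<n} E weight_dist A)"
        by (simp add: enn2ereal_ennreal)
      \<comment> \<open>Passing from the minimum to ln x costs only a constant factor, since
        \<delta> \<le> x powr (-\<gamma>) gives ln (1/\<delta>) \<ge> \<gamma> ln x.\<close>
      moreover have "ereal (c * (real n / \<epsilon>)) * min (ln_inverse \<delta>) (ereal (ln x))
          \<le> ereal (c * (real n / \<epsilon>)) * ereal (ln x)"
        using c assms by (intro ereal_mult_left_mono) auto
      ultimately show "ereal (c * (real n / \<epsilon>)) * min (ln_inverse \<delta>) (ereal (ln (real m / real n)))
          \<le> enn2ereal (expected_error {..<n} E weight_dist A)"
        by (simp add: x_def)
    qed (use cE in auto)
  qed
qed

end
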